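(* Let $k$ be an odd positive integer and let $F_k:\mathbb{N}\to\mathbb{N}$ be given by $F_k(n)=\frac{3n+k}{2}$ if $n$ is odd and $F_k(n)=\frac{n}{2}$ if $n$ is even. Let $C$ be a cycle of $F_k$ with minimal element $T_0$, and let $(u_1,d_1,\dots,u_s,d_s)$ be the orb sequence of the cycle read starting from $T_0$, i.e. positive integers such that iterating $F_k$ from $T_0$ one first meets $u_1$ odd values, then $d_1$ even values, then $u_2$ odd values, etc., ending with $d_s$ even values, after which one returns to $T_0$ for the first time. Then $$T_0=\frac{k\alpha}{\beta},$$ where $U=\sum_{i=1}^s u_i$, $D=\sum_{i=1}^s d_i$, $\beta=2^{U+D}-3^{U}$ and $$\alpha=\sum_{i=1}^{s} 2^{\sum_{j=1}^{i-1}(u_j+d_j)}\,(3^{u_i}-2^{u_i})\,3^{\sum_{j=i+1}^{s}u_j}$$ (empty sums are $0$).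
   Context: A cycle of $F_k$ is a set $\{x,F_k(x),\dots,F_k^{p-1}(x)\}$ with $x\in\mathbb{N}$, $p\ge1$, $F_k^p(x)=x$. (The minimal element of a cycle is necessarily odd, so the orb sequence starting at $T_0$ begins with an odd block.) *)

theory Defs
  imports Complex_Main
begin

(* The division is exact whenever k is odd. *)
definition F :: "nat \<Rightarrow> nat \<Rightarrow> nat" where
  "F k n = (if odd n then (3 * n + k) div 2 else n div 2)"

(* Cycles live in the positive integers: the fixed point 0 is excluded by x > 0.
   As usual p need not be the least period of x. *)
definition is_cycle :: "nat \<Rightarrow> nat set \<Rightarrow> bool" where
  "is_cycle k C \<longleftrightarrow>
     (\<exists>x p. x > 0 \<and> p \<ge> 1 \<and> (F k ^^ p) x = x \<and> C = (\<lambda>i. (F k ^^ i) x) ` {..<p})"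

(* Number of iterations carried out before the i-th odd block begins. *)
definition block_start :: "(nat \<Rightarrow> nat) \<Rightarrow> (nat \<Rightarrow> nat) \<Rightarrow> nat \<Rightarrow> nat" where
  "block_start u d i = (\<Sum>j\<in>{1..<i}. u j + d j)"

(* The sequence (u 1, d 1, ..., u s, d s); values of u and d outside {1..s} are irrelevant.
   The last two conditions say that T is met again for the first time after all s blocks. *)
definition is_orb_sequence ::
    "nat \<Rightarrow> nat \<Rightarrow> nat \<Rightarrow> (nat \<Rightarrow> nat) \<Rightarrow> (nat \<Rightarrow> nat) \<Rightarrow> bool" where
  "is_orb_sequence k T s u d \<longleftrightarrow>
     s \<ge> 1 \<and>
     (\<forall>i\<in>{1..s}. u i \<ge> 1 \<and> d i \<ge> 1) \<and>
     (\<forall>i\<in>{1..s}. \<forall>m<u i. odd ((F k ^^ (block_start u d i + m)) T)) \<and>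
     (\<forall>i\<in>{1..s}. \<forall>m<d i. even ((F k ^^ (block_start u d i + u i + m)) T)) \<and>
     (F k ^^ (\<Sum>i=1..s. u i + d i)) T = T \<and>
     (\<forall>m. 0 < m \<and> m < (\<Sum>i=1..s. u i + d i) \<longrightarrow> (F k ^^ m) T \<noteq> T)"

definition orb_alpha :: "nat \<Rightarrow> (nat \<Rightarrow> nat) \<Rightarrow> (nat \<Rightarrow> nat) \<Rightarrow> int" where
  "orb_alpha s u d =
     (\<Sum>i=1..s. 2 ^ (\<Sum>j\<in>{1..<i}. u j + d j) * (3 ^ u i - 2 ^ u i) * 3 ^ (\<Sum>j=i+1..s. u j))"

definition orb_beta :: "nat \<Rightarrow> (nat \<Rightarrow> nat) \<Rightarrow> (nat \<Rightarrow> nat) \<Rightarrow> int" where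
  "orb_beta s u d = 2 ^ ((\<Sum>i=1..s. u i) + (\<Sum>i=1..s. d i)) - 3 ^ (\<Sum>i=1..s. u i)"

end

(* One step sends x + k to 3/2 (x + k) when x is odd and x to x / 2 when x is even.  Hence
   n blocks send T to x with 2^(u_1 + d_1 + ... + u_n + d_n) x = 3^(u_1 + ... + u_n) T + k alpha_n,
   where alpha_n is alpha truncated to the first n blocks.  Closing the cycle (n = s, x = T)
   gives beta T = k alpha, and beta is nonzero because it is odd. *)
theory Submission imports Defs
begin

text \<open>Shifting by \<open>k\<close> turns the affine odd step into pure multiplication by 3/2,
  so a whole block telescopes; clearing denominators keeps it in \<open>nat\<close>.\<close>

lemma funpow_F_odd_block:
  assumes "odd k" and "\<forall>i<m. odd ((F k ^^ i) x)"
  shows "2 ^ m * ((F k ^^ m) x + k) = 3 ^ m * (x + k)"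
  using assms(2)
proof (induction m)
  case (Suc m)
  let ?y = "(F k ^^ m) x"
  have "odd ?y" using Suc.prems by simp
  \<comment> \<open>The \<open>div\<close> is exact: \<open>?y\<close> and \<open>k\<close> are both
    odd, so \<open>3 * ?y + k\<close> is even.\<close>
  then have "2 * F k ?y = 3 * ?y + k"
    using \<open>odd k\<close> by (simp add: F_def)
  then have "2 * (F k ?y + k) = 3 * (?y + k)" by simp
  then have "2 ^ Suc m * (F k ?y + k) = 3 * (2 ^ m * (?y + k))"
    by (metis mult.assoc mult.left_commute power_Suc2)
  also have "\<dots> = 3 ^ Suc m * (x + k)" using Suc by simp
  finally show ?case by simp
qed simp

lemma funpow_F_even_block:
  assumes "\<forall>i<m. even ((F k ^^ i) x)"
  shows "2 ^ m * (F k ^^ m) x = x"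
  using assms
proof (induction m)
  case (Suc m)
  let ?y = "(F k ^^ m) x"
  have "even ?y" using Suc.prems by simp
  then have "2 * F k ?y = ?y" by (simp add: F_def)
  then have "2 ^ Suc m * F k ?y = 2 ^ m * ?y"
    by (metis mult.assoc power_Suc2)
  then show ?case using Suc by simp
qed simp

lemma block_start_Suc:
  assumes "i \<ge> 1"
  shows "block_start u d (Suc i) = block_start u d i + (u i + d i)"
  using assms by (simp add: block_start_def)

lemma block_start_Suc_eq_sum: "block_start u d (Suc n) = (\<Sum>i=1..n. u i + d i)"
  by (simp add: block_start_def atLeastLessThanSuc_atLeastAtMost)

text \<open>A further block lengthens the tail sum of \<open>u\<close> in every old term, whence the
  common factor \<open>3 ^ u (Suc n)\<close>; the new last term has an empty tail.\<close>

lemma orb_alpha_Suc: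
  "orb_alpha (Suc n) u d =
     3 ^ u (Suc n) * orb_alpha n u d
     + 2 ^ block_start u d (Suc n) * (3 ^ u (Suc n) - 2 ^ u (Suc n))"
proof -
  have "(\<Sum>j=i+1..Suc n. u j) = (\<Sum>j=i+1..n. u j) + u (Suc n)" if "i \<le> n" for i
    using that by simp
  then have "(\<Sum>i=1..n. 2 ^ (\<Sum>j\<in>{1..<i}. u j + d j) * (3 ^ u i - 2 ^ u i) * 3 ^ (\<Sum>j=i+1..Suc n. u j))
      = 3 ^ u (Suc n) * orb_alpha n u d"
    unfolding orb_alpha_def sum_distrib_left
    by (intro sum.cong) (auto simp: power_add)
  then show ?thesis
    by (simp add: orb_alpha_def block_start_def)
qed

lemma funpow_F_blocks:
  assumes "odd k"
    and "\<forall>i\<in>{1..n}. \<forall>m<u i. odd ((F k ^^ (block_start u d i + m)) T)"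
    and "\<forall>i\<in>{1..n}. \<forall>m<d i. even ((F k ^^ (block_start u d i + u i + m)) T)"
  shows "2 ^ block_start u d (Suc n) * int ((F k ^^ block_start u d (Suc n)) T)
    = 3 ^ (\<Sum>i=1..n. u i) * int T + int k * orb_alpha n u d"
  using assms(2,3)
proof (induction n)
  case 0
  then show ?case by (simp add: block_start_def orb_alpha_def)
next
  case (Suc n)
  let ?B = "block_start u d (Suc n)" and ?u = "u (Suc n)" and ?d = "d (Suc n)"
  define x where "x = (F k ^^ ?B) T"
  define y where "y = (F k ^^ ?u) x"
  define z where "z = (F k ^^ ?d) y"
  \<comment> \<open>The parity hypotheses speak of iterates of \<open>T\<close>, the block lemmas of
    iterates of a block's first value; these shifts translate.\<close>
  have x_iter: "(F k ^^ m) x = (F k ^^ (?B + m)) T" for m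
    by (simp add: x_def funpow_add add.commute[of ?B])
  have y_iter: "(F k ^^ m) y = (F k ^^ (?B + ?u + m)) T" for m
    by (simp add: y_def x_def funpow_add add.commute[of _ m] add.commute[of ?B])
  have B: "block_start u d (Suc (Suc n)) = ?B + ?u + ?d"
    by (simp add: block_start_Suc)
  have z: "(F k ^^ block_start u d (Suc (Suc n))) T = z"
    by (simp add: B z_def y_iter)
  have "2 ^ ?u * (y + k) = 3 ^ ?u * (x + k)"
    unfolding y_def using \<open>odd k\<close>
    by (rule funpow_F_odd_block) (use Suc.prems(1) in \<open>simp add: x_iter\<close>)
  then have "int (2 ^ ?u * (y + k)) = int (3 ^ ?u * (x + k))" by (rule arg_cong)
  then have odd_block: "2 ^ ?u * (int y + int k) = 3 ^ ?u * (int x + int k)" by simp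
  have "2 ^ ?d * z = y"
    unfolding z_def
    by (rule funpow_F_even_block) (use Suc.prems(2) in \<open>simp add: y_iter\<close>)
  then have even_block: "2 ^ ?d * int z = int y"
    by (metis of_nat_mult of_nat_numeral of_nat_power)
  have IH: "2 ^ ?B * int x = 3 ^ (\<Sum>i=1..n. u i) * int T + int k * orb_alpha n u d"
    using Suc by (simp add: x_def)
  have "2 ^ (?B + ?u + ?d) * int z = 2 ^ ?B * (2 ^ ?u * (2 ^ ?d * int z))"
    by (simp add: power_add)
  \<comment> \<open>Undoing the shift by \<open>k\<close> at the end of the odd block produces the
    factor \<open>3 ^ ?u - 2 ^ ?u\<close> of alpha.\<close>
  also have "\<dots> = 2 ^ ?B * (3 ^ ?u * (int x + int k) - 2 ^ ?u * int k)"
    unfolding even_block odd_block[symmetric] by (simp add: algebra_simps)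
  also have "\<dots> = 3 ^ ?u * (2 ^ ?B * int x) + int k * (2 ^ ?B * (3 ^ ?u - 2 ^ ?u))"
    by (simp add: algebra_simps)
  also have "\<dots> = 3 ^ (\<Sum>i=1..Suc n. u i) * int T + int k * orb_alpha (Suc n) u d"
    unfolding IH orb_alpha_Suc by (simp add: power_add algebra_simps)
  \<comment> \<open>The order matters: \<open>B\<close> would rewrite the left-hand side of
    \<open>z\<close>.\<close>
  finally show ?case by (simp only: z) (simp only: B)
qed

lemma orb_beta_nonzero:
  assumes "s \<ge> 1" and "u 1 \<ge> 1"
  shows "orb_beta s u d \<noteq> 0"
proof -
  \<comment> \<open>This makes the exponent of 2 in beta positive, so an odd power of 3 is
    subtracted from an even number.\<close>
  have "u 1 \<le> (\<Sum>i=1..s. u i)"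
    using assms by (intro member_le_sum) auto
  then have "odd (orb_beta s u d)"
    using assms by (simp add: orb_beta_def)
  then show ?thesis by auto
qed

theorem theorem5:
  fixes k s :: nat and C :: "nat set" and u d :: "nat \<Rightarrow> nat"
  assumes "odd k" and "k > 0"
    and "is_cycle k C"
    and "is_orb_sequence k (Min C) s u d"
  shows "rat_of_nat (Min C) = rat_of_nat k * rat_of_int (orb_alpha s u d) / rat_of_int (orb_beta s u d)"
proof -
  let ?T = "Min C"
  note orb = assms(4)[unfolded is_orb_sequence_def]
  have "2 ^ block_start u d (Suc s) * int ((F k ^^ block_start u d (Suc s)) ?T)
      = 3 ^ (\<Sum>i=1..s. u i) * int ?T + int k * orb_alpha s u d"
    using \<open>odd k\<close> orb by (intro funpow_F_blocks) auto
  \<comment> \<open>\<open>block_start u d (Suc s)\<close> is the length of all \<open>s\<close>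
    blocks, so the iterate is \<open>?T\<close> again.\<close>
  then have "int ?T * orb_beta s u d = int k * orb_alpha s u d"
    using orb by (simp add: block_start_Suc_eq_sum orb_beta_def sum.distrib algebra_simps)
  then have "rat_of_int (int ?T * orb_beta s u d) = rat_of_int (int k * orb_alpha s u d)"
    by (rule arg_cong)
  moreover have "orb_beta s u d \<noteq> 0"
    using orb by (intro orb_beta_nonzero) auto
  ultimately show ?thesis
    by (simp add: field_simps)
qed

end
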